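(* Let $A,B\subset\mathbb{R}$. Suppose that $f:A\to B$ is a homeomorphism and $B$ is a closed subset of $\mathbb{R}$. If $C\subset A$ is a Cantor set, then $f(C)\subset B$ is also a Cantor set.
   Context: $A$ and $B$ carry the subspace topology from $\mathbb{R}$. A set $X\subset\mathbb{R}$ is nowhere dense if $\operatorname{int}(\overline{X})=\emptyset$ (closure and interior in $\mathbb{R}$). A set $C\subset\mathbb{R}$ is perfect if $C=C'$, where $C'$ is the set of all accumulation points of $C$ in $\mathbb{R}$. A Cantor set is a nonempty set $C\subset\mathbb{R}$ that is nowhere dense and perfect (this is the definition used; boundedness is not required). *)

theory Defs
  imports "HOL-Analysis.Analysis"
begin

definition nowhere_dense :: "real set \<Rightarrow> bool" where
  "nowhere_dense X \<longleftrightarrow> interior (closure X) = {}"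

definition perfect_set :: "real set \<Rightarrow> bool" where
  "perfect_set C \<longleftrightarrow> C = {x. x islimpt C}"

(* Boundedness is not required, so a Cantor set in this sense need not be compact. *)
definition cantor_set :: "real set \<Rightarrow> bool" where
  "cantor_set C \<longleftrightarrow> C \<noteq> {} \<and> nowhere_dense C \<and> perfect_set C"

end

theory Submission
  imports Defs
begin

text \<open>
  A perfect set is exactly a closed set without isolated points, so a Cantor set is a nonempty
  closed set without isolated points and with empty interior.  Having no isolated points is a
  topological property of the set itself, hence invariant under homeomorphism.  On the line, so is
  having empty interior: a set of reals has an interior point exactly when some connected subset of
  it has two distinct points (\<open>interior_empty_iff_connected_trivial\<close>), and connectedness of a subset
  does not depend on the surrounding space.

  Closedness is the one condition that depends on the ambient line.  It survives because \<open>C\<close>, being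
  closed in \<open>\<real>\<close>, is relatively closed in \<open>A\<close>; its image is then relatively closed in \<open>B\<close>, and the
  closedness of \<open>B\<close> turns this back into closedness in \<open>\<real>\<close>.
\<close>

text \<open>
  Connected subsets of the line are intervals, so one with two points contains the nondegenerate
  segment between them.  The right-hand side does not refer to the ambient line, whereas interior
  does; this is what makes empty interior invariant under homeomorphisms of subsets of the line.
\<close>

lemma interior_empty_iff_connected_trivial:
  fixes S :: "real set"
  shows "interior S = {} \<longleftrightarrow>
    (\<forall>K x y. K \<subseteq> S \<longrightarrow> connected K \<longrightarrow> x \<in> K \<longrightarrow> y \<in> K \<longrightarrow> x = y)"
proof
  assume empty: "interior S = {}"
  have no_gap: "\<not> x < y" if "K \<subseteq> S" "connected K" "x \<in> K" "y \<in> K" for K and x y :: real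
  proof
    assume "x < y"
    have "{x..y} \<subseteq> S"
      using that connected_contains_Icc by blast
    then have "interior {x..y} \<subseteq> interior S"
      by (rule interior_mono)
    with \<open>x < y\<close> empty show False
      by simp
  qed
  show "\<forall>K x y. K \<subseteq> S \<longrightarrow> connected K \<longrightarrow> x \<in> K \<longrightarrow> y \<in> K \<longrightarrow> x = y"
    using no_gap by (meson linorder_neqE)
next
  assume trivial: "\<forall>K x y. K \<subseteq> S \<longrightarrow> connected K \<longrightarrow> x \<in> K \<longrightarrow> y \<in> K \<longrightarrow> x = y"
  show "interior S = {}"
  proof (rule ccontr)
    assume "interior S \<noteq> {}"
    then obtain x e where "e > 0" and "cball x e \<subseteq> S"
      by (auto simp: mem_interior_cball)
    moreover have "connected (cball x e)" "x \<in> cball x e" "x + e \<in> cball x e"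
      using \<open>e > 0\<close> by (auto simp: dist_real_def)
    ultimately have "x = x + e"
      using trivial by blast
    with \<open>e > 0\<close> show False
      by simp
  qed
qed

lemma homeomorphism_interior_empty:
  fixes S T :: "real set"
  assumes hom: "homeomorphism S T f g" and "interior S = {}"
  shows "interior T = {}"
  unfolding interior_empty_iff_connected_trivial
proof (intro allI impI)
  fix K x y
  assume K: "K \<subseteq> T" "connected K" and xy: "x \<in> K" "y \<in> K"
  have "connected (g ` K)"
    using K hom by (meson connected_continuous_image continuous_on_subset homeomorphism_cont2)
  moreover have "g ` K \<subseteq> S"
    using K hom by (auto simp: homeomorphism_def)
  ultimately have "g x = g y"
    using \<open>interior S = {}\<close> xy unfolding interior_empty_iff_connected_trivial by blast
  then show "x = y"
    using hom K xy by (metis homeomorphism_apply2 subsetD)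
qed

text \<open>
  Injectivity is what keeps the image of a sequence in \<open>S - {x}\<close> away from \<open>f x\<close>.
\<close>

lemma islimpt_inj_continuous_image:
  fixes f :: "'a::first_countable_topology \<Rightarrow> 'b::first_countable_topology"
  assumes "continuous_on S f" "inj_on f S" "x \<in> S" "x islimpt S"
  shows "f x islimpt f ` S"
proof -
  obtain u where u: "\<And>n. u n \<in> S - {x}" "u \<longlonglongrightarrow> x"
    using \<open>x islimpt S\<close> by (auto simp: islimpt_sequential)
  have "(\<lambda>n. f (u n)) \<longlonglongrightarrow> f x"
    using assms(1) u(2) \<open>x \<in> S\<close> u(1) by (intro continuous_on_tendsto_compose[of S f]) auto
  moreover have "f (u n) \<in> f ` S - {f x}" for n
    using u(1)[of n] assms(2,3) by (auto dest: inj_onD)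
  ultimately show ?thesis
    unfolding islimpt_sequential by (intro exI[of _ "\<lambda>n. f (u n)"]) simp
qed

lemma perfect_set_iff: "perfect_set C \<longleftrightarrow> closed C \<and> (\<forall>x\<in>C. x islimpt C)"
  unfolding perfect_set_def closed_limpt by blast

lemma cantor_set_iff:
  "cantor_set C \<longleftrightarrow> C \<noteq> {} \<and> closed C \<and> (\<forall>x\<in>C. x islimpt C) \<and> interior C = {}"
  unfolding cantor_set_def perfect_set_iff nowhere_dense_def by (auto simp: closure_closed)

theorem proposition1p1:
  fixes A B C :: "real set" and f :: "real \<Rightarrow> real"
  assumes "\<exists>g. homeomorphism A B f g"
    and "closed B"
    and "C \<subseteq> A"
    and "cantor_set C"
  shows "f ` C \<subseteq> B \<and> cantor_set (f ` C)"
proof -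
  obtain g where hom: "homeomorphism A B f g"
    using assms(1) by blast
  have C: "C \<noteq> {}" "closed C" "\<forall>x\<in>C. x islimpt C" "interior C = {}"
    using \<open>cantor_set C\<close> by (auto simp: cantor_set_iff)
  have sub: "f ` C \<subseteq> B"
    using hom \<open>C \<subseteq> A\<close> by (auto simp: homeomorphism_def)
  have homC: "homeomorphism C (f ` C) f g"
    using hom \<open>C \<subseteq> A\<close> sub by (rule homeomorphism_of_subsets) simp
  have "closedin (top_of_set A) C"
    using \<open>closed C\<close> \<open>C \<subseteq> A\<close> by (rule closed_subset[rotated])
  then have "closedin (top_of_set B) (f ` C)"
    using hom homeomorphism_imp_closed_map by blast
  then have "closed (f ` C)"
    using \<open>closed B\<close> by (rule closedin_closed_trans)
  moreover have "\<forall>y\<in>f ` C. y islimpt f ` C"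
  proof -
    have "continuous_on C f" "inj_on f C"
      using homC by (auto simp: homeomorphism_def intro: inj_on_inverseI)
    then show ?thesis
      using C(3) islimpt_inj_continuous_image by blast
  qed
  moreover have "interior (f ` C) = {}"
    using homC C(4) by (rule homeomorphism_interior_empty)
  ultimately show ?thesis
    using sub C(1) by (auto simp: cantor_set_iff)
qed

end
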